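(* For every fixed $\varepsilon\in(0,1)$, as $n\to\infty$, $$t_{\varepsilon,2\to1}(G_n)=\Theta_{\varepsilon}\bigl(\gamma(G_n)\bigr).$$ That is, for every $\varepsilon\in(0,1)$ there exist constants $c_\varepsilon,C_\varepsilon>0$ and $N_\varepsilon\in\mathbb{N}$, depending only on $\varepsilon$, such that for all integers $n\ge N_\varepsilon$, $$c_\varepsilon\,\gamma(G_n)\le t_{\varepsilon,2\to1}(G_n)\le C_\varepsilon\,\gamma(G_n).$$
   Context: **The graph $G_n$.** For $n\ge 2$, $G_n$ is the simple graph on $n+1$ vertices obtained from the complete graph $K_n$ by adding one new vertex $\ell$ (the leaf) joined by a single edge to one fixed vertex of $K_n$. Thus $|V(G_n)|=n+1$ and $|E(G_n)|=\binom n2+1$. **The averaging process.** Let $G=(V,E)$ be a finite connected simple graph and $v(0)\in\mathbb{R}^V$ a deterministic starting vector. At each time $t=0,1,2,\dots$, an edge $\{i,j\}\in E$ is chosen uniformly at random, independently of all other choices, and $$v_i(t+1)=v_j(t+1)=\frac{v_i(t)+v_j(t)}{2},\qquad v_k(t+1)=v_k(t)\ \text{ for } k\ne i,j.$$ The sum of the entries of $v(t)$ does not depend on $t$. Let $\bar v=\frac{1}{|V|}\bigl(\sum_i v_i(0)\bigr)\mathbf{1}$ be the constant vector whose entries equal the average. **Mixing time.** For $p,q\ge1$ and $\varepsilon>0$, $$t_{\varepsilon,p\to q}(G)=\min\Bigl\{t\in\mathbb{N}\ :\ \forall\, v(0)\in\mathbb{R}^V \text{ with } \|v(0)\|_p=1,\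 \bigl(\mathbb{E}\bigl[\|v(t)-\bar v\|_q^q\bigr]\bigr)^{1/q}\le\varepsilon\Bigr\},$$ where $\|\cdot\|_p$ is the usual (unnormalized) $\ell^p$ norm on $\mathbb{R}^V$. **The quantity $\gamma$.** $\gamma(G)=|E|/\lambda_2(G)$, where $\lambda_2(G)$ is the second-smallest eigenvalue (counted with multiplicity) of the combinatorial Laplacian $L=D-A$ of $G$ ($D$ the diagonal degree matrix, $A$ the adjacency matrix). *)

theory Defs
  imports "HOL-Probability.Probability" "Jordan_Normal_Form.Char_Poly"
begin

text \<open>
  A finite simple graph is given by its number \<open>N\<close> of vertices, the vertex set being \<open>{..<N}\<close>,
  and its set \<open>E\<close> of edges, which are two-element subsets of \<open>{..<N}\<close>. Vectors indexed by
  the vertices are functions \<open>nat \<Rightarrow> real\<close>, of which only the values on \<open>{..<N}\<close> matter.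
\<close>

definition lp_norm :: "nat \<Rightarrow> real \<Rightarrow> (nat \<Rightarrow> real) \<Rightarrow> real" where
  "lp_norm N p v = (\<Sum>i<N. \<bar>v i\<bar> powr p) powr (1 / p)"

definition mean_entry :: "nat \<Rightarrow> (nat \<Rightarrow> real) \<Rightarrow> real" where
  "mean_entry N v = (\<Sum>i<N. v i) / real N"

definition average_edge :: "(nat \<Rightarrow> real) \<Rightarrow> nat set \<Rightarrow> nat \<Rightarrow> real" where
  "average_edge v e = (\<lambda>k. if k \<in> e then (\<Sum>i\<in>e. v i) / 2 else v k)"

text \<open>
  The law of \<open>v(t)\<close> in the averaging process started at the deterministic vector \<open>v0\<close>; the edge
  used in each step is drawn uniformly from \<open>E\<close>, independently of the past.
\<close>

primrec averaging_law :: "nat set set \<Rightarrow> (nat \<Rightarrow> real) \<Rightarrow> nat \<Rightarrow> (nat \<Rightarrow> real) pmf" where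
  "averaging_law E v0 0 = return_pmf v0"
| "averaging_law E v0 (Suc t) =
     bind_pmf (averaging_law E v0 t) (\<lambda>v. map_pmf (average_edge v) (pmf_of_set E))"

text \<open>
  The mixing time is the minimum of a set of natural numbers; taking the infimum in \<open>enat\<close> makes it
  \<open>\<infinity>\<close> should that set be empty, so that an upper bound on it is never vacuous.
\<close>

definition mixing_time :: "nat \<Rightarrow> nat set set \<Rightarrow> real \<Rightarrow> real \<Rightarrow> real \<Rightarrow> enat" where
  "mixing_time N E \<epsilon> p q =
     Inf {enat t | t. \<forall>v0. lp_norm N p v0 = 1 \<longrightarrow>
       (measure_pmf.expectation (averaging_law E v0 t)
          (\<lambda>v. lp_norm N q (\<lambda>i. v i - mean_entry N v0) powr q)) powr (1 / q) \<le> \<epsilon>}"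

definition degree_matrix :: "nat \<Rightarrow> nat set set \<Rightarrow> real mat" where
  "degree_matrix N E = mat N N (\<lambda>(i, j). if i = j then real (card {e \<in> E. i \<in> e}) else 0)"

definition adjacency_matrix :: "nat \<Rightarrow> nat set set \<Rightarrow> real mat" where
  "adjacency_matrix N E = mat N N (\<lambda>(i, j). if i \<noteq> j \<and> {i, j} \<in> E then 1 else 0)"

definition laplacian :: "nat \<Rightarrow> nat set set \<Rightarrow> real mat" where
  "laplacian N E = degree_matrix N E - adjacency_matrix N E"

text \<open>
  The Laplacian is real symmetric, so the real roots of its characteristic polynomial, taken with
  multiplicity, are all its \<open>N\<close> eigenvalues; list index \<open>1\<close> is the second-smallest one.
\<close>

definition lambda2 :: "nat \<Rightarrow> nat set set \<Rightarrow> real" where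
  "lambda2 N E = sorted_list_of_multiset (proots (char_poly (laplacian N E))) ! 1"

definition gamma_graph :: "nat \<Rightarrow> nat set set \<Rightarrow> real" where
  "gamma_graph N E = real (card E) / lambda2 N E"

text \<open>
  The edges of the graph \<open>G\<^sub>n\<close> on the \<open>n + 1\<close> vertices \<open>0, \<dots>, n\<close>: the complete graph on
  \<open>0, \<dots>, n - 1\<close> with the leaf \<open>n\<close> attached to the vertex \<open>0\<close>.
\<close>

definition clique_leaf_edges :: "nat \<Rightarrow> nat set set" where
  "clique_leaf_edges n = {{i, j} | i j. i < j \<and> j < n} \<union> {{0, n}}"

end

theory Submission
  imports Defs
begin

text \<open>
  The second eigenvalue of the Laplacian is \<open>1\<close>, so \<open>\<gamma>\<close> is the number
  \<open>m \<approx> n\<^sup>2 / 2\<close> of edges.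

  Lower bound: an eigenfunction for the eigenvalue \<open>1\<close> gives a linear functional whose
  expectation shrinks by the factor \<open>1 - 1 / (2 m)\<close> per step, and which, normalised to be
  \<open>1\<close> at the indicator of the leaf, is dominated by the \<open>\<ell>\<^sup>1\<close> distance to
  the mean.

  Upper bound: let \<open>S\<close> and \<open>D\<close> be the sums of squared deviations from the mean over
  all vertices and over the clique. By Cauchy-Schwarz the squared \<open>\<ell>\<^sup>1\<close> distance is at
  most \<open>8 S + 2 n D\<close>. A Poincare inequality makes the expectation of \<open>S\<close> decay on
  the time scale \<open>m\<close>. The clique edges contract \<open>D\<close> on the time scale
  \<open>n\<close>, while the leaf edge, chosen with probability \<open>1 / m\<close>, raises it to at most
  \<open>S\<close>; so the expectation of \<open>D\<close> is soon of order \<open>1 / n\<close> times that of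
  \<open>S\<close>, which compensates the factor \<open>n\<close> that a comparison of norms costs.
\<close>

subsection \<open>Variation under averaging\<close>

definition variation :: "nat \<Rightarrow> (nat \<Rightarrow> real) \<Rightarrow> real" where
  "variation N v = (\<Sum>i<N. (v i - mean_entry N v)\<^sup>2)"

lemma variation_nonneg: "variation N v \<ge> 0"
  unfolding variation_def by (intro sum_nonneg) auto

lemma variation_alt:
  assumes "N > 0"
  shows "variation N v = (\<Sum>i<N. (v i)\<^sup>2) - (\<Sum>i<N. v i)\<^sup>2 / real N"
proof -
  define m where "m = mean_entry N v"
  have m: "(\<Sum>i<N. v i) = real N * m"
    using assms by (simp add: m_def mean_entry_def)
  have "variation N v = (\<Sum>i<N. (v i)\<^sup>2 - 2 * m * v i + m\<^sup>2)"
    by (simp add: variation_def m_def power2_diff algebra_simps)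
  also have "\<dots> = (\<Sum>i<N. (v i)\<^sup>2) - 2 * m * (\<Sum>i<N. v i) + real N * m\<^sup>2"
    by (simp add: sum.distrib sum_subtractf sum_distrib_left)
  also have "\<dots> = (\<Sum>i<N. (v i)\<^sup>2) - (\<Sum>i<N. v i)\<^sup>2 / real N"
    using assms unfolding m by (simp add: power2_eq_square)
  finally show ?thesis .
qed

text \<open>Only the two endpoints change. An arbitrary \<open>h\<close> covers both the identity,
  for the mean, and squared deviations, for the variation.\<close>

lemma sum_average_edge:
  fixes h :: "real \<Rightarrow> real"
  assumes "i < N" "j < N" "i \<noteq> j"
  shows "(\<Sum>k<N. h (average_edge v {i, j} k)) =
    (\<Sum>k<N. h (v k)) - h (v i) - h (v j) + 2 * h ((v i + v j) / 2)"
proof -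
  have split: "(\<Sum>k<N. g k) = g i + g j + (\<Sum>k\<in>{..<N} - {i, j}. g k)" for g :: "nat \<Rightarrow> real"
    using assms by (subst sum.subset_diff[of "{i, j}"]) auto
  have "(\<Sum>k\<in>{..<N} - {i, j}. h (average_edge v {i, j} k)) = (\<Sum>k\<in>{..<N} - {i, j}. h (v k))"
    by (intro sum.cong) (auto simp: average_edge_def)
  then show ?thesis
    using assms by (subst (1 2) split) (simp add: average_edge_def)
qed

lemma mean_entry_average_edge:
  assumes "i < N" "j < N" "i \<noteq> j"
  shows "mean_entry N (average_edge v {i, j}) = mean_entry N v"
  using sum_average_edge[OF assms, of "\<lambda>x. x" v] by (simp add: mean_entry_def field_simps)

text \<open>The mean stays fixed, and replacing deviations x and y by two copies of (x + y) / 2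
  lowers the sum of squares by half of (x - y)^2.\<close>

lemma variation_average_edge:
  assumes "i < N" "j < N" "i \<noteq> j"
  shows "variation N (average_edge v {i, j}) = variation N v - (v i - v j)\<^sup>2 / 2"
proof -
  have "variation N (average_edge v {i, j}) =
      (\<Sum>k<N. (average_edge v {i, j} k - mean_entry N v)\<^sup>2)"
    by (simp add: variation_def mean_entry_average_edge[OF assms])
  also have "\<dots> = variation N v - (v i - v j)\<^sup>2 / 2"
    unfolding variation_def
    by (subst sum_average_edge[OF assms, of "\<lambda>x. (x - mean_entry N v)\<^sup>2"])
       (simp add: field_simps power2_eq_square)
  finally show ?thesis .
qed

text \<open>Splits the total variation into the share of the clique and a leaf term; in particular
  the variation over the clique never exceeds the total.\<close>

lemma variation_Suc:
  assumes "N > 0"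
  shows "variation (Suc N) v =
    variation N v + real N / real (Suc N) * (v N - mean_entry N v)\<^sup>2"
proof -
  define s where "s = (\<Sum>i<N. v i)"
  show ?thesis
    using assms
    by (simp add: variation_alt mean_entry_def s_def[symmetric] divide_simps)
       (simp add: algebra_simps power2_eq_square)
qed

text \<open>Lagrange's identity. By it the Dirichlet form of the complete graph is \<open>N\<close>
  times the variation.\<close>

lemma sum_pairs_sq_diff:
  "(\<Sum>j<N. \<Sum>i<j. (v i - v j :: real)\<^sup>2) = real N * (\<Sum>i<N. (v i)\<^sup>2) - (\<Sum>i<N. v i)\<^sup>2"
proof (induction N)
  case (Suc N)
  have "(\<Sum>i<N. (v i - v N)\<^sup>2) = (\<Sum>i<N. (v i)\<^sup>2) - 2 * v N * (\<Sum>i<N. v i) + real N * (v N)\<^sup>2"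
    by (simp add: power2_diff sum.distrib sum_subtractf sum_distrib_left algebra_simps)
  with Suc show ?case by (simp add: algebra_simps power2_eq_square)
qed simp

lemma sum_pairs_sq_diff_variation:
  assumes "N > 0"
  shows "(\<Sum>j<N. \<Sum>i<j. (v i - v j)\<^sup>2) = real N * variation N v"
  using assms by (simp add: sum_pairs_sq_diff variation_alt algebra_simps)

subsection \<open>The clique with a leaf\<close>

text \<open>Each clique edge is \<open>{i, j}\<close> for exactly one pair with
  \<open>i < j\<close>, and the leaf edge is new because it contains the vertex
  \<open>n\<close>.\<close>

lemma sum_clique_leaf_edges:
  assumes "n \<ge> 1"
  shows "(\<Sum>e\<in>clique_leaf_edges n. h e) = (\<Sum>j<n. \<Sum>i<j. h {i, j}) + h {0, n}"
proof -
  let ?A = "Sigma {..<n} (\<lambda>j. {..<j})" and ?g = "\<lambda>(j, i). {i, j :: nat}"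
  have img: "{{i, j} | i j. i < j \<and> j < n} = ?g ` ?A" by force
  have inj: "inj_on ?g ?A"
  proof (rule inj_onI, clarify)
    fix j i j' i' :: nat
    assume lt: "i < j" "i' < j'" and "{i, j} = {i', j'}"
    from this(3) have "i = i' \<and> j = j' \<or> i = j' \<and> j = i'"
      by (simp only: doubleton_eq_iff)
    with lt show "j = j' \<and> i = i'" by linarith
  qed
  have "?g ` ?A \<subseteq> Pow {..<n}" by auto
  moreover have "{0, n} \<notin> Pow {..<n}" by simp
  ultimately have new: "{0, n} \<notin> ?g ` ?A" by (rule contra_subsetD)
  have "finite (?g ` ?A)" by simp
  then have "(\<Sum>e\<in>clique_leaf_edges n. h e) = (\<Sum>e\<in>?g ` ?A. h e) + h {0, n}"
    unfolding clique_leaf_edges_def img using new by (simp add: add.commute)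
  also have "(\<Sum>e\<in>?g ` ?A. h e) = (\<Sum>x\<in>?A. h (?g x))"
    by (subst sum.reindex[OF inj]) (simp add: o_def)
  also have "\<dots> = (\<Sum>j<n. \<Sum>i<j. h {i, j})"
    by (subst sum.Sigma) (auto simp: case_prod_unfold)
  finally show ?thesis .
qed

lemma clique_leaf_edgeE:
  assumes "e \<in> clique_leaf_edges n" "n \<ge> 1"
  obtains i j where "e = {i, j}" "i < Suc n" "j < Suc n" "i \<noteq> j"
  using assms unfolding clique_leaf_edges_def by fastforce

lemma finite_clique_leaf_edges: "finite (clique_leaf_edges n)"
  by (rule finite_subset[of _ "Pow {..n}"]) (auto simp: clique_leaf_edges_def)

lemma clique_leaf_edges_nonempty: "clique_leaf_edges n \<noteq> {}"
  by (simp add: clique_leaf_edges_def)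

lemma card_clique_leaf_edges:
  assumes "n \<ge> 1"
  shows "real (card (clique_leaf_edges n)) = real n * (real n - 1) / 2 + 1"
proof -
  have "(\<Sum>j<n. real j) = real n * (real n - 1) / 2" for n
    by (induction n) (auto simp: field_simps)
  then show ?thesis
    using sum_clique_leaf_edges[OF assms, of "\<lambda>_. 1 :: real"] by simp
qed

section \<open>One-step bounds for the two variations\<close>

text \<open>With \<open>a = v\<^sub>0 - \<mu>\<close> and \<open>b = v\<^sub>n - \<mu>\<close>, where \<open>\<mu>\<close> is the mean over the clique, this reduces
  to \<open>(n - 1) a\<^sup>2 + (a - b)\<^sup>2 \<ge> (n - 1) b\<^sup>2 / n\<close>. The sharp constant is \<open>1\<close> instead of \<open>1 / 2\<close>.\<close>

lemma clique_leaf_poincare: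
  assumes "n \<ge> 2"
  shows "variation (Suc n) v / 2 \<le> real n * variation n v + (v 0 - v n)\<^sup>2"
proof -
  define a where "a = v 0 - mean_entry n v"
  define b where "b = v n - mean_entry n v"
  define D where "D = variation n v"
  have D: "a\<^sup>2 \<le> D"
    unfolding D_def variation_def a_def using assms
    by (intro member_le_sum[of 0 _ "\<lambda>i. (v i - mean_entry n v)\<^sup>2"]) auto
  have ab: "(v 0 - v n)\<^sup>2 = (a - b)\<^sup>2" by (simp add: a_def b_def)
  have "(real n - 1) * b\<^sup>2 \<le> real n * ((real n - 1) * a\<^sup>2 + (a - b)\<^sup>2)"
  proof -
    \<comment> \<open>This square is exactly the difference of the two sides of the claim.\<close>
    have "0 \<le> (real n * a - b)\<^sup>2" by simp
    also have "\<dots> = real n * ((real n - 1) * a\<^sup>2 + (a - b)\<^sup>2) - (real n - 1) * b\<^sup>2"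
      by (simp add: algebra_simps power2_eq_square)
    finally show ?thesis by simp
  qed
  \<comment> \<open>Since \<open>n \<le> 2 * (n - 1)\<close>, the factor \<open>(n - 1) / n\<close>
    may be replaced by the constant \<open>1 / 2\<close>.\<close>
  moreover have "real n * b\<^sup>2 \<le> 2 * ((real n - 1) * b\<^sup>2)"
    using mult_right_mono[of "real n" "2 * (real n - 1)" "b\<^sup>2"] assms by (simp add: algebra_simps)
  ultimately have "real n * b\<^sup>2 \<le> real n * (2 * ((real n - 1) * a\<^sup>2 + (a - b)\<^sup>2))"
    by linarith
  then have "b\<^sup>2 / 2 \<le> (real n - 1) * a\<^sup>2 + (a - b)\<^sup>2"
    using assms by (simp add: mult_le_cancel_left)
  moreover have "(real n - 1) * a\<^sup>2 \<le> (real n - 1) * D"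
    using D assms by (intro mult_left_mono) auto
  moreover have "real n / real (Suc n) * b\<^sup>2 \<le> b\<^sup>2"
    by (rule mult_left_le_one_le) auto
  moreover have "0 \<le> D" unfolding D_def by (rule variation_nonneg)
  moreover have "variation (Suc n) v = D + real n / real (Suc n) * b\<^sup>2"
    using assms by (simp add: variation_Suc D_def b_def)
  ultimately show ?thesis
    unfolding ab D_def[symmetric] by (simp add: algebra_simps)
qed

text \<open>Each edge lowers the variation by half its squared difference. One factor
  \<open>1 / 2\<close> of the \<open>1 / 4\<close> comes from this, the other from
  \<open>clique_leaf_poincare\<close>.\<close>

lemma variation_step:
  assumes "n \<ge> 2"
  shows "(\<Sum>e\<in>clique_leaf_edges n. variation (Suc n) (average_edge v e))
    \<le> (real (card (clique_leaf_edges n)) - 1 / 4) * variation (Suc n) v"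
proof -
  let ?S = "variation (Suc n) v"
  have n: "n \<ge> 1" using assms by simp
  have "(\<Sum>e\<in>clique_leaf_edges n. variation (Suc n) (average_edge v e) - ?S)
      = (\<Sum>j<n. \<Sum>i<j. - (v i - v j)\<^sup>2 / 2) - (v 0 - v n)\<^sup>2 / 2"
    using n by (simp add: sum_clique_leaf_edges variation_average_edge)
  also have "\<dots> = - (real n * variation n v + (v 0 - v n)\<^sup>2) / 2"
    using n by (simp add: sum_negf sum_divide_distrib[symmetric] sum_pairs_sq_diff_variation)
  also have "\<dots> \<le> - ?S / 4"
    using clique_leaf_poincare[OF assms, of v] by simp
  finally show ?thesis
    by (simp add: sum_subtractf algebra_simps)
qed

text \<open>The clique edges together remove \<open>n / 2\<close> times the variation over the
  clique. The leaf edge may raise it, but only up to the total variation, which averaging does not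
  increase; replacing its summand gives the \<open>- 1\<close>.\<close>

lemma clique_variation_step:
  assumes "n \<ge> 2"
  shows "(\<Sum>e\<in>clique_leaf_edges n. variation n (average_edge v e))
    \<le> (real (card (clique_leaf_edges n)) - 1 - real n / 2) * variation n v + variation (Suc n) v"
proof -
  let ?D = "variation n v" and ?u = "average_edge v {0, n}"
  have n: "n \<ge> 1" using assms by simp
  have "variation n ?u \<le> variation (Suc n) ?u"
    using n by (simp add: variation_Suc)
  also have "\<dots> \<le> variation (Suc n) v"
    using n by (simp add: variation_average_edge)
  finally have leaf: "variation n ?u \<le> variation (Suc n) v" .
  have "(\<Sum>e\<in>clique_leaf_edges n. variation n (average_edge v e) - ?D)
      = (\<Sum>j<n. \<Sum>i<j. - (v i - v j)\<^sup>2 / 2) + variation n ?u - ?D"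
    using n by (simp add: sum_clique_leaf_edges variation_average_edge)
  also have "\<dots> = - real n / 2 * ?D + variation n ?u - ?D"
    using n by (simp add: sum_negf sum_divide_distrib[symmetric] sum_pairs_sq_diff_variation)
  finally show ?thesis using leaf
    by (simp add: sum_subtractf algebra_simps)
qed

text \<open>Deviations from \<open>M\<close> sum to zero, so passing from \<open>M\<close> to the
  clique mean \<open>\<mu>\<close> costs only the leaf's deviation. Cauchy-Schwarz is then applied
  to the \<open>n\<close> clique entries.\<close>

lemma l1_deviation_bound:
  assumes "n \<ge> 1"
  shows "(\<Sum>i<Suc n. \<bar>v i - mean_entry (Suc n) v\<bar>)\<^sup>2
    \<le> 8 * variation (Suc n) v + 2 * real n * variation n v"
proof -
  define \<mu> where "\<mu> = mean_entry n v"
  define M where "M = mean_entry (Suc n) v"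
  define y where "y = v n - M"
  define T where "T = (\<Sum>i<n. \<bar>v i - \<mu>\<bar>)"
  have "real n * \<mu> + v n = (real n + 1) * M"
    using assms by (simp add: \<mu>_def M_def mean_entry_def divide_simps)
  then have "real n * (\<mu> - M) = - y"
    by (simp add: y_def algebra_simps)
  then have y: "real n * \<bar>\<mu> - M\<bar> = \<bar>y\<bar>"
    by (metis abs_minus abs_mult abs_of_nat)
  have "(\<Sum>i<n. \<bar>v i - M\<bar>) \<le> (\<Sum>i<n. \<bar>v i - \<mu>\<bar> + \<bar>\<mu> - M\<bar>)"
    by (intro sum_mono) linarith
  also have "\<dots> = T + \<bar>y\<bar>" by (simp add: sum.distrib T_def y)
  finally have "(\<Sum>i<Suc n. \<bar>v i - M\<bar>) \<le> T + 2 * \<bar>y\<bar>" by (simp add: y_def)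
  then have "(\<Sum>i<Suc n. \<bar>v i - M\<bar>)\<^sup>2 \<le> (T + 2 * \<bar>y\<bar>)\<^sup>2"
    by (intro power_mono) (auto intro: sum_nonneg)
  also have "\<dots> \<le> 2 * T\<^sup>2 + 8 * y\<^sup>2"
    using zero_le_power2[of "T - 2 * \<bar>y\<bar>"] by (simp add: power2_sum power2_diff)
  also have "T\<^sup>2 \<le> real n * variation n v"
    using Cauchy_Schwarz_ineq_sum[of "\<lambda>_. 1" "\<lambda>i. \<bar>v i - \<mu>\<bar>" "{..<n}"]
    by (simp add: T_def variation_def \<mu>_def)
  also have "y\<^sup>2 \<le> variation (Suc n) v"
    unfolding variation_def y_def M_def
    by (intro member_le_sum[of n _ "\<lambda>i. (v i - mean_entry (Suc n) v)\<^sup>2"]) auto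
  finally show ?thesis by (simp add: M_def)
qed

text \<open>Bernoulli gives \<open>t * a \<le> (1 + a) ^ t\<close>, and
  \<open>(1 - a) * (1 + a) \<le> 1\<close>. Decay of order \<open>1 / t\<close> suffices because
  \<epsilon> is fixed.\<close>

lemma one_minus_power_le:
  fixes a :: real
  assumes "0 < a" "a \<le> 1" "t > 0"
  shows "(1 - a) ^ t \<le> 1 / (real t * a)"
proof -
  have "(1 - a) ^ t * (real t * a) \<le> (1 - a) ^ t * (1 + a) ^ t"
    using assms Bernoulli_inequality[of a t] by (intro mult_left_mono) auto
  also have "\<dots> = (1 - a\<^sup>2) ^ t"
    by (simp add: power_mult_distrib[symmetric] algebra_simps power2_eq_square)
  also have "\<dots> \<le> 1"
    using assms by (intro power_le_one) (auto simp: power_le_one)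
  finally show ?thesis using assms by (simp add: field_simps)
qed

subsection \<open>The second eigenvalue\<close>

lemma clique_leaf_edges_iff:
  assumes "n \<ge> 1"
  shows "i \<noteq> j \<and> {i, j} \<in> clique_leaf_edges n \<longleftrightarrow>
    i \<noteq> j \<and> i < n \<and> j < n \<or> i = 0 \<and> j = n \<or> i = n \<and> j = 0"
proof -
  have "{i, j} \<in> {{i, j} | i j. i < j \<and> j < n} \<longleftrightarrow> i \<noteq> j \<and> i < n \<and> j < n"
  proof
    assume "{i, j} \<in> {{i, j} | i j. i < j \<and> j < n}"
    then obtain k l where "{i, j} = {k, l}" "k < l" "l < n" by auto
    then show "i \<noteq> j \<and> i < n \<and> j < n"
      unfolding doubleton_eq_iff by linarith
  next
    assume ij: "i \<noteq> j \<and> i < n \<and> j < n"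
    have "{i, j} = {min i j, max i j}" by (auto simp: min_def max_def)
    moreover have "min i j < max i j" "max i j < n" using ij by auto
    ultimately show "{i, j} \<in> {{i, j} | i j. i < j \<and> j < n}" by blast
  qed
  moreover have "{i, j} = {0, n} \<longleftrightarrow> i = 0 \<and> j = n \<or> i = n \<and> j = 0"
    by (rule doubleton_eq_iff)
  ultimately show ?thesis
    using assms unfolding clique_leaf_edges_def by auto
qed

lemma card_incident_edges:
  assumes "\<And>e. e \<in> E \<Longrightarrow> card e = 2"
  shows "card {e \<in> E. i \<in> e} = card {j. i \<noteq> j \<and> {i, j} \<in> E}"
proof -
  have "{e \<in> E. i \<in> e} = (\<lambda>j. {i, j}) ` {j. i \<noteq> j \<and> {i, j} \<in> E}"
  proof (intro equalityI subsetI)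
    fix e assume "e \<in> {e \<in> E. i \<in> e}"
    then have "e \<in> E" "i \<in> e" by auto
    then obtain k l where "e = {k, l}" "k \<noteq> l"
      using assms[of e] unfolding card_2_iff by blast
    with \<open>i \<in> e\<close> obtain j where "e = {i, j}" "i \<noteq> j"
      by (metis insertE insert_commute singletonD)
    with \<open>e \<in> E\<close> show "e \<in> (\<lambda>j. {i, j}) ` {j. i \<noteq> j \<and> {i, j} \<in> E}" by blast
  qed auto
  moreover have "inj_on (\<lambda>j. {i, j}) A" for A
    by (rule inj_onI) (metis doubleton_eq_iff)
  ultimately show ?thesis by (simp add: card_image)
qed

text \<open>Each row is a constant plus corrections at single columns, so that sums along a row
  reduce to Kronecker deltas.\<close>

definition clique_leaf_laplacian :: "nat \<Rightarrow> nat \<Rightarrow> nat \<Rightarrow> real" where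
  "clique_leaf_laplacian n i j =
     (if i = 0 then of_bool (j = 0) * (real n + 1) - 1
      else if i = n then of_bool (j = n) - of_bool (j = 0)
      else of_bool (j = i) * real n + of_bool (j = n) - 1)"

lemma laplacian_clique_leaf_edges:
  assumes "n \<ge> 2"
  shows "laplacian (Suc n) (clique_leaf_edges n) =
    mat (Suc n) (Suc n) (\<lambda>(i, j). clique_leaf_laplacian n i j)"
proof -
  let ?E = "clique_leaf_edges n"
  have n: "n \<ge> 1" using assms by simp
  have card2: "card e = 2" if "e \<in> ?E" for e
    using that assms unfolding clique_leaf_edges_def by auto
  have deg: "real (card {e \<in> ?E. i \<in> e}) = (if i = 0 then real n else if i = n then 1 else real n - 1)"
    if "i \<le> n" for i
  proof -
    have "{j. i \<noteq> j \<and> {i, j} \<in> ?E} =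
        (if i = 0 then {1..n} else if i = n then {0} else {..<n} - {i})"
      unfolding clique_leaf_edges_iff[OF n] using that assms by auto
    moreover have "card {e \<in> ?E. i \<in> e} = card {j. i \<noteq> j \<and> {i, j} \<in> ?E}"
      by (rule card_incident_edges) (rule card2)
    moreover have "card (if i = 0 then {1..n} else if i = n then {0} else {..<n} - {i})
        = (if i = 0 then n else if i = n then 1 else n - 1)"
      using that by simp
    ultimately show ?thesis using assms by (simp add: of_nat_diff)
  qed
  have adj: "(if i \<noteq> j \<and> {i, j} \<in> ?E then 1 else 0 :: real) =
    (if i \<noteq> j \<and> i < n \<and> j < n \<or> i = 0 \<and> j = n \<or> i = n \<and> j = 0 then 1 else 0)" for i j
    by (simp only: clique_leaf_edges_iff[OF n])
  show ?thesis
  proof (rule eq_matI)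
    fix i j
    assume "i < dim_row (mat (Suc n) (Suc n) (\<lambda>(i, j). clique_leaf_laplacian n i j))"
      and "j < dim_col (mat (Suc n) (Suc n) (\<lambda>(i, j). clique_leaf_laplacian n i j))"
    then have ij: "i \<le> n" "j \<le> n" by auto
    then have "laplacian (Suc n) ?E $$ (i, j) =
        (if i = j then real (card {e \<in> ?E. i \<in> e}) else 0)
        - (if i \<noteq> j \<and> {i, j} \<in> ?E then 1 else 0)"
      by (simp add: laplacian_def degree_matrix_def adjacency_matrix_def del: insert_iff)
    also have "\<dots> = clique_leaf_laplacian n i j"
      unfolding adj deg[OF ij(1)] clique_leaf_laplacian_def using ij assms by auto
    finally show "laplacian (Suc n) ?E $$ (i, j) =
        mat (Suc n) (Suc n) (\<lambda>(i, j). clique_leaf_laplacian n i j) $$ (i, j)"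
      using ij by simp
  qed (simp_all add: laplacian_def degree_matrix_def adjacency_matrix_def)
qed

text \<open>In the basis \<open>\<one>, e\<^sub>0, e\<^sub>n, e\<^sub>2, \<dots>, e\<^sub>n\<^sub>-\<^sub>1\<close>, whose elements are the columns of \<open>P\<close> below, the
  Laplacian is upper triangular: \<open>L \<one> = 0\<close>, \<open>L e\<^sub>0 = (n + 1) e\<^sub>0 - \<one>\<close>, \<open>L e\<^sub>n = e\<^sub>n - e\<^sub>0\<close> and
  \<open>L e\<^sub>i = n e\<^sub>i + e\<^sub>n - \<one>\<close> otherwise.\<close>

lemma char_poly_laplacian_clique_leaf_edges:
  assumes "n \<ge> 2"
  shows "char_poly (laplacian (Suc n) (clique_leaf_edges n)) =
    (\<Prod>a\<leftarrow>[0, real n + 1, 1] @ replicate (n - 2) (real n). [:- a, 1:])"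
proof -
  \<comment> \<open>\<open>\<tau> j\<close> is the vertex whose unit vector is column
    \<open>j \<ge> 1\<close> of \<open>P\<close>, and \<open>\<sigma>\<close> leads back from
    vertices to columns. The unit vector of the vertex 1 gives way to the all-ones vector in column
    0.\<close>
  define \<sigma> where "\<sigma> = (\<lambda>i :: nat. if i = 0 then 1 else if i = n then 2 else Suc i)"
  define \<tau> where "\<tau> = (\<lambda>j :: nat. if j = 1 then 0 else if j = 2 then n else j - 1)"
  define p :: "nat \<Rightarrow> nat \<Rightarrow> real" where
    "p = (\<lambda>i j. if j = 0 then 1 else of_bool (i = \<tau> j))"
  \<comment> \<open>The inverse of \<open>P\<close>: column \<open>j\<close> holds the coordinates
    of the unit vector of the vertex \<open>j\<close>. For the vertex 1 this is the all-ones vector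
    minus all other basis vectors.\<close>
  define q :: "nat \<Rightarrow> nat \<Rightarrow> real" where
    "q = (\<lambda>i j. if j = 1 then (if i = 0 then 1 else - 1) else of_bool (i = \<sigma> j))"
  define d where "d = (\<lambda>j :: nat. if j = 0 then 0 else if j = 1 then real n + 1 else if j = 2 then 1 else real n)"
  define t where "t = (\<lambda>i j :: nat. if i = j then d j else if i = 0 \<and> j = 1 then - 1
    else if i = 1 \<and> j = 2 then - 1 else if i = 2 \<and> 3 \<le> j then 1
    else if i = 0 \<and> 3 \<le> j then - 1 else 0)"
  define P where "P = mat (Suc n) (Suc n) (\<lambda>(i, j). p i j)"
  define Q where "Q = mat (Suc n) (Suc n) (\<lambda>(i, j). q i j)"
  define T where "T = mat (Suc n) (Suc n) (\<lambda>(i, j). t i j)"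
  define L where "L = mat (Suc n) (Suc n) (\<lambda>(i, j). clique_leaf_laplacian n i j)"
  have carrier: "P \<in> carrier_mat (Suc n) (Suc n)" "Q \<in> carrier_mat (Suc n) (Suc n)"
      "T \<in> carrier_mat (Suc n) (Suc n)" "L \<in> carrier_mat (Suc n) (Suc n)"
    by (simp_all add: P_def Q_def T_def L_def)
  have row: "(\<Sum>k<Suc n. p i k * x k) = x 0 + (if i = 1 then 0 else x (\<sigma> i))"
    if "i < Suc n" for i and x :: "nat \<Rightarrow> real"
  proof -
    have "p i k = of_bool (k = 0) + (if i = 1 then 0 else of_bool (k = \<sigma> i))" if "k < Suc n" for k
      using \<open>i < Suc n\<close> that assms by (auto simp: p_def \<sigma>_def \<tau>_def split: if_splits)
    then have "(\<Sum>k<Suc n. p i k * x k) =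
        (\<Sum>k<Suc n. (if k = 0 then x k else 0) + (if i = 1 then 0 else (if k = \<sigma> i then x k else 0)))"
      by (intro sum.cong) auto
    also have "\<dots> = x 0 + (if i = 1 then 0 else x (\<sigma> i))"
      using that assms by (auto simp: sum.distrib \<sigma>_def simp del: sum.lessThan_Suc)
    finally show ?thesis .
  qed
  have col: "(\<Sum>k<Suc n. x k * p k j) = (if j = 0 then sum x {..<Suc n} else x (\<tau> j))"
    if "j < Suc n" for j and x :: "nat \<Rightarrow> real"
  proof -
    have "\<tau> j < Suc n" using that assms by (auto simp: \<tau>_def)
    then show ?thesis
      by (auto simp: p_def of_bool_def if_distrib[of "(*) _"] cong: if_cong simp del: sum.lessThan_Suc)
  qed
  have rowsum: "(\<Sum>k<Suc n. clique_leaf_laplacian n i k) = 0" if "i < Suc n" for i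
  proof -
    have delta: "(\<Sum>k<Suc n. of_bool (k = l) * c) = (c :: real)" if "l \<le> n" for l c
      using that by (simp add: of_bool_def if_distrib[of "\<lambda>x. x * _"] cong: if_cong del: sum.lessThan_Suc)
    show ?thesis
      using that assms delta[of 0] delta[of n] delta[of i] delta[of 0 1] delta[of n 1]
      by (cases "i = 0"; cases "i = n")
         (simp_all add: clique_leaf_laplacian_def sum.distrib sum_subtractf del: sum.lessThan_Suc)
  qed
  have PQ: "P * Q = 1\<^sub>m (Suc n)"
  proof (rule eq_matI)
    fix i j assume ij: "i < dim_row (1\<^sub>m (Suc n) :: real mat)" "j < dim_col (1\<^sub>m (Suc n) :: real mat)"
    then have "(P * Q) $$ (i, j) = (\<Sum>k<Suc n. p i k * q k j)"
      by (simp add: P_def Q_def scalar_prod_def atLeast0LessThan del: sum.lessThan_Suc)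
    also have "\<dots> = (if i = j then 1 else 0)"
      using ij assms by (subst row) (auto simp: q_def \<sigma>_def)
    finally show "(P * Q) $$ (i, j) = 1\<^sub>m (Suc n) $$ (i, j)" using ij by simp
  qed (simp_all add: P_def Q_def)
  then have QP: "Q * P = 1\<^sub>m (Suc n)"
    by (rule mat_mult_left_right_inverse[OF carrier(1,2)])
  have LP: "L * P = P * T"
  proof (rule eq_matI)
    fix i j assume "i < dim_row (P * T)" "j < dim_col (P * T)"
    then have ij: "i < Suc n" "j < Suc n" by (simp_all add: P_def T_def)
    then have "(L * P) $$ (i, j) = (\<Sum>k<Suc n. clique_leaf_laplacian n i k * p k j)"
      by (simp add: L_def P_def scalar_prod_def atLeast0LessThan del: sum.lessThan_Suc)
    also have "\<dots> = (if j = 0 then 0 else clique_leaf_laplacian n i (\<tau> j))"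
      using ij by (simp add: col rowsum del: sum.lessThan_Suc)
    also have "\<dots> = t 0 j + (if i = 1 then 0 else t (\<sigma> i) j)"
      using ij assms by (auto simp: clique_leaf_laplacian_def t_def d_def \<sigma>_def \<tau>_def)
    also have "\<dots> = (\<Sum>k<Suc n. p i k * t k j)" by (rule row[OF ij(1), symmetric])
    also have "\<dots> = (P * T) $$ (i, j)"
      using ij by (simp add: P_def T_def scalar_prod_def atLeast0LessThan del: sum.lessThan_Suc)
    finally show "(L * P) $$ (i, j) = (P * T) $$ (i, j)" .
  qed (simp_all add: P_def L_def T_def)
  have "L = L * (P * Q)" using carrier by (simp add: PQ)
  also have "\<dots> = P * T * Q"
    using carrier by (simp add: LP[symmetric] assoc_mult_mat[of L _ _ P _ Q])
  finally have "similar_mat L T"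
    using carrier PQ QP by (intro similar_matI[of _ _ P Q "Suc n"]) auto
  then have "char_poly L = char_poly T" by (rule char_poly_similar)
  also have "\<dots> = (\<Prod>a\<leftarrow>diag_mat T. [:- a, 1:])"
  proof (rule char_poly_upper_triangular[OF carrier(3)])
    show "upper_triangular T" by (auto simp: T_def t_def)
  qed
  also have "diag_mat T = map d [0..<Suc n]"
    by (auto simp: diag_mat_def T_def t_def intro!: map_cong simp del: upt_Suc)
  \<comment> \<open>Columns 3 to \<open>n\<close> account for the \<open>n - 2\<close> copies of the
    eigenvalue \<open>n\<close>.\<close>
  also have "[0..<Suc n] = [0, 1, 2] @ [3..<Suc n]"
    using assms by (simp add: upt_conv_Cons numeral_eq_Suc del: upt_Suc)
  also have "map d \<dots> = [0, real n + 1, 1] @ replicate (n - 2) (real n)"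
    by (auto simp: d_def map_replicate_const[symmetric] intro!: nth_equalityI simp del: upt_Suc)
  finally show ?thesis
    by (simp only: L_def laplacian_clique_leaf_edges[OF assms])
qed

lemma proots_prod_linear_factors:
  "proots (\<Prod>a\<leftarrow>xs. [:- a, 1:]) = mset (xs :: 'a :: idom list)"
proof (induction xs)
  case (Cons x xs)
  have "(\<Prod>a\<leftarrow>xs. [:- a, 1:]) \<noteq> 0" by (auto simp: prod_list_zero_iff)
  then have "proots ([:- x, 1:] * (\<Prod>a\<leftarrow>xs. [:- a, 1:])) = {#x#} + proots (\<Prod>a\<leftarrow>xs. [:- a, 1:])"
    by (subst proots_mult) auto
  with Cons.IH show ?case by simp
qed simp

text \<open>Sorted, the eigenvalues are 0, 1, then \<open>n - 2\<close> times \<open>n\<close>, then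
  \<open>n + 1\<close>.\<close>

lemma lambda2_clique_leaf_edges:
  assumes "n \<ge> 2"
  shows "lambda2 (Suc n) (clique_leaf_edges n) = 1"
proof -
  let ?r = "replicate (n - 2) (real n)"
  have "mset ([0, real n + 1, 1] @ ?r) = mset (0 # 1 # ?r @ [real n + 1])" by simp
  moreover have "sorted (0 # 1 # ?r @ [real n + 1])"
    using assms by (auto simp: sorted_append)
  ultimately have "sorted_list_of_multiset (mset ([0, real n + 1, 1] @ ?r)) = 0 # 1 # ?r @ [real n + 1]"
    by (metis sorted_list_of_multiset_mset sorted_sort_id)
  then show ?thesis
    unfolding lambda2_def char_poly_laplacian_clique_leaf_edges[OF assms] proots_prod_linear_factors
    by simp
qed

subsection \<open>Expectations along the process\<close>

lemma finite_set_averaging_law: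
  assumes "finite E" "E \<noteq> {}"
  shows "finite (set_pmf (averaging_law E v0 t))"
  by (induction t) (use assms in auto)

text \<open>Conditioning on the vector at time \<open>t\<close> turns one-step estimates, summed
  over the edges, into recursions for expectations.\<close>

lemma expectation_averaging_law_Suc:
  fixes f :: "(nat \<Rightarrow> real) \<Rightarrow> real"
  assumes "finite E" "E \<noteq> {}"
  shows "measure_pmf.expectation (averaging_law E v0 (Suc t)) f =
    measure_pmf.expectation (averaging_law E v0 t)
      (\<lambda>v. (\<Sum>e\<in>E. f (average_edge v e)) / real (card E))"
proof -
  let ?A = "set_pmf (averaging_law E v0 t)"
  have fin: "finite ?A" by (rule finite_set_averaging_law[OF assms])
  have "measure_pmf.expectation (averaging_law E v0 (Suc t)) f =
     (\<Sum>a\<in>?A. pmf (averaging_law E v0 t) a *\<^sub>R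
        measure_pmf.expectation (map_pmf (average_edge a) (pmf_of_set E)) f)"
    unfolding averaging_law.simps
    by (rule pmf_expectation_bind) (use fin assms in auto)
  also have "\<dots> = measure_pmf.expectation (averaging_law E v0 t)
      (\<lambda>v. (\<Sum>e\<in>E. f (average_edge v e)) / real (card E))"
    by (subst integral_measure_pmf_real[OF fin])
       (auto simp: integral_pmf_of_set assms mult.commute)
  finally show ?thesis .
qed

lemma expectation_averaging_law_mono:
  fixes f g :: "(nat \<Rightarrow> real) \<Rightarrow> real"
  assumes "finite E" "E \<noteq> {}"
    and "\<And>v. v \<in> set_pmf (averaging_law E v0 t) \<Longrightarrow> f v \<le> g v"
  shows "measure_pmf.expectation (averaging_law E v0 t) f
    \<le> measure_pmf.expectation (averaging_law E v0 t) g"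
  using assms
  by (intro integral_mono_AE integrable_measure_pmf_finite finite_set_averaging_law)
     (auto simp: AE_measure_pmf_iff)

lemma integrable_averaging_law:
  fixes f :: "(nat \<Rightarrow> real) \<Rightarrow> real"
  assumes "finite E" "E \<noteq> {}"
  shows "integrable (measure_pmf (averaging_law E v0 t)) f"
  using assms by (intro integrable_measure_pmf_finite finite_set_averaging_law)

text \<open>\<open>mixing_time\<close> measures deviations from the initial mean,
  \<open>variation\<close> those from the current one; this identifies the two.\<close>

lemma mean_entry_averaging_law:
  assumes "n \<ge> 1" "v \<in> set_pmf (averaging_law (clique_leaf_edges n) v0 t)"
  shows "mean_entry (Suc n) v = mean_entry (Suc n) v0"
  using assms(2)
proof (induction t arbitrary: v)
  case (Suc t)
  then obtain u e where "u \<in> set_pmf (averaging_law (clique_leaf_edges n) v0 t)"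
    and e: "e \<in> clique_leaf_edges n" and "v = average_edge u e"
    by (auto simp: finite_clique_leaf_edges clique_leaf_edges_nonempty)
  with Suc.IH clique_leaf_edgeE[OF e assms(1)] show ?case
    by (metis mean_entry_average_edge)
qed simp

section \<open>Expected variations and the upper bound\<close>

lemma expectation_variation_le:
  assumes "n \<ge> 2"
  defines "m \<equiv> real (card (clique_leaf_edges n))"
  shows "measure_pmf.expectation (averaging_law (clique_leaf_edges n) v0 t) (variation (Suc n))
    \<le> (1 - 1 / (4 * m)) ^ t * variation (Suc n) v0"
proof (induction t)
  case (Suc t)
  let ?E = "clique_leaf_edges n" and ?S = "variation (Suc n)"
  let ?exp = "measure_pmf.expectation (averaging_law ?E v0 t)"
  have m: "m \<ge> 1"
    using assms(1) by (simp add: m_def card_clique_leaf_edges)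
  have "measure_pmf.expectation (averaging_law ?E v0 (Suc t)) ?S
      = ?exp (\<lambda>v. (\<Sum>e\<in>?E. ?S (average_edge v e)) / m)"
    unfolding m_def
    by (rule expectation_averaging_law_Suc[OF finite_clique_leaf_edges clique_leaf_edges_nonempty])
  also have "\<dots> \<le> ?exp (\<lambda>v. (1 - 1 / (4 * m)) * ?S v)"
  proof (rule expectation_averaging_law_mono[OF finite_clique_leaf_edges clique_leaf_edges_nonempty])
    fix v
    have "(\<Sum>e\<in>?E. ?S (average_edge v e)) / m \<le> (m - 1 / 4) * ?S v / m"
      using variation_step[OF assms(1), of v] m
      by (intro divide_right_mono) (auto simp: m_def)
    also have "\<dots> = (1 - 1 / (4 * m)) * ?S v"
      using m by (simp add: field_simps)
    finally show "(\<Sum>e\<in>?E. ?S (average_edge v e)) / m \<le> (1 - 1 / (4 * m)) * ?S v" .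
  qed
  also have "\<dots> = (1 - 1 / (4 * m)) * ?exp ?S" by simp
  also have "\<dots> \<le> (1 - 1 / (4 * m)) * ((1 - 1 / (4 * m)) ^ t * ?S v0)"
    using Suc m by (intro mult_left_mono) auto
  finally show ?case by (simp add: mult.assoc)
qed simp

text \<open>The factor \<open>2 / n\<close> bounds the ratio of the rate \<open>1 / m\<close> at which the leaf edge feeds the
  variation over the clique to the rate, about \<open>n / (2 m)\<close>, at which the clique edges remove it.\<close>

lemma expectation_clique_variation_le:
  assumes "n \<ge> 2"
  defines "m \<equiv> real (card (clique_leaf_edges n))"
  shows "measure_pmf.expectation (averaging_law (clique_leaf_edges n) v0 t) (variation n)
    \<le> (2 / real n * (1 - 1 / (4 * m)) ^ t + (1 - (1 + real n / 2) / m) ^ t) * variation (Suc n) v0"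
proof (induction t)
  case 0
  have "variation n v0 \<le> variation (Suc n) v0"
    using assms(1) by (simp add: variation_Suc)
  also have "\<dots> \<le> (2 / real n + 1) * variation (Suc n) v0"
    by (simp add: distrib_right variation_nonneg)
  finally show ?case by simp
next
  case (Suc t)
  let ?E = "clique_leaf_edges n" and ?S = "variation (Suc n)" and ?D = "variation n"
  let ?exp = "measure_pmf.expectation (averaging_law ?E v0 t)"
  define \<rho> where "\<rho> = 1 - 1 / (4 * m)"
  define \<beta> where "\<beta> = 1 - (1 + real n / 2) / m"
  have m: "m \<ge> 1 + real n / 2"
    using assms(1) by (simp add: m_def card_clique_leaf_edges field_simps)
  then have "m > 0" by linarith
  have rho: "\<rho> \<ge> 0" using m \<open>m > 0\<close> by (simp add: \<rho>_def field_simps)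
  have beta: "\<beta> \<ge> 0" using m \<open>m > 0\<close> by (simp add: \<beta>_def)
  have S0: "?S v0 \<ge> 0" by (rule variation_nonneg)
  note int = integrable_averaging_law[OF finite_clique_leaf_edges clique_leaf_edges_nonempty]
  have "measure_pmf.expectation (averaging_law ?E v0 (Suc t)) ?D
      = ?exp (\<lambda>v. (\<Sum>e\<in>?E. ?D (average_edge v e)) / m)"
    unfolding m_def
    by (rule expectation_averaging_law_Suc[OF finite_clique_leaf_edges clique_leaf_edges_nonempty])
  also have "\<dots> \<le> ?exp (\<lambda>v. \<beta> * ?D v + 1 / m * ?S v)"
  proof (rule expectation_averaging_law_mono[OF finite_clique_leaf_edges clique_leaf_edges_nonempty])
    fix v
    have "(\<Sum>e\<in>?E. ?D (average_edge v e)) / m \<le> ((m - 1 - real n / 2) * ?D v + ?S v) / m"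
      using clique_variation_step[OF assms(1), of v] \<open>m > 0\<close>
      by (intro divide_right_mono) (auto simp: m_def)
    also have "\<dots> = \<beta> * ?D v + 1 / m * ?S v"
      using \<open>m > 0\<close> by (simp add: \<beta>_def field_simps)
    finally show "(\<Sum>e\<in>?E. ?D (average_edge v e)) / m \<le> \<beta> * ?D v + 1 / m * ?S v" .
  qed
  also have "\<dots> = \<beta> * ?exp ?D + 1 / m * ?exp ?S"
    by (subst Bochner_Integration.integral_add) (auto intro: int)
  also have "\<dots> \<le> \<beta> * ((2 / real n * \<rho> ^ t + \<beta> ^ t) * ?S v0) + 1 / m * (\<rho> ^ t * ?S v0)"
    using Suc expectation_variation_le[OF assms(1), of v0 t] beta \<open>m > 0\<close>
    unfolding \<rho>_def[symmetric] \<beta>_def[symmetric] m_def[symmetric]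
    by (intro add_mono mult_left_mono) auto
  also have "\<dots> = ((2 / real n * \<beta> + 1 / m) * \<rho> ^ t + \<beta> ^ Suc t) * ?S v0"
    by (simp add: algebra_simps)
  also have "\<dots> \<le> (2 / real n * \<rho> * \<rho> ^ t + \<beta> ^ Suc t) * ?S v0"
  proof -
    \<comment> \<open>The summand \<open>n / 2\<close> in \<open>\<beta>\<close> cancels
      \<open>1 / m\<close> exactly, which explains the constant \<open>2 / n\<close>. What remains
      is \<open>2 / (n * m) \<ge> 1 / (2 * n * m)\<close>.\<close>
    have "2 / real n * \<beta> + 1 / m \<le> 2 / real n * \<rho>"
      using \<open>m > 0\<close> assms(1) by (simp add: \<rho>_def \<beta>_def field_simps)
    then show ?thesis
      using rho S0 by (intro mult_right_mono add_mono) auto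
  qed
  finally show ?case unfolding \<rho>_def \<beta>_def by (simp only: power_Suc mult.assoc)
qed

lemma expectation_l1_deviation_le:
  assumes n: "n \<ge> 2" and "\<epsilon> > 0" and v0: "variation (Suc n) v0 \<le> 1"
    and t: "52 * real (card (clique_leaf_edges n)) \<le> \<epsilon>\<^sup>2 * real t"
  shows "measure_pmf.expectation (averaging_law (clique_leaf_edges n) v0 t)
    (\<lambda>v. \<Sum>i<Suc n. \<bar>v i - mean_entry (Suc n) v0\<bar>) \<le> \<epsilon>"
proof -
  let ?E = "clique_leaf_edges n" and ?S = "variation (Suc n)" and ?D = "variation n"
  let ?exp = "measure_pmf.expectation (averaging_law ?E v0 t)"
  define m where "m = real (card ?E)"
  define \<rho> where "\<rho> = 1 - 1 / (4 * m)"
  define \<beta> where "\<beta> = 1 - (1 + real n / 2) / m"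
  have m: "m \<ge> 1 + real n / 2"
    using n by (simp add: m_def card_clique_leaf_edges field_simps)
  then have "m > 0" by linarith
  have "t > 0"
    using t \<open>m > 0\<close> by (cases t) (auto simp: m_def)
  have rho: "0 \<le> \<rho> ^ t" "\<rho> ^ t \<le> 4 * m / real t"
  proof -
    show "0 \<le> \<rho> ^ t" using m by (simp add: \<rho>_def field_simps)
    show "\<rho> ^ t \<le> 4 * m / real t"
      using one_minus_power_le[of "1 / (4 * m)" t] m \<open>t > 0\<close> by (simp add: \<rho>_def field_simps)
  qed
  \<comment> \<open>The factor \<open>n\<close> from Cauchy-Schwarz is absorbed by the fast rate,
    about \<open>n / (2 * m)\<close>, of the clique edges.\<close>
  have beta: "0 \<le> \<beta> ^ t" "real n * \<beta> ^ t \<le> 2 * m / real t"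
  proof -
    have "\<beta> \<ge> 0" using m \<open>m > 0\<close> by (simp add: \<beta>_def)
    then show "0 \<le> \<beta> ^ t" by simp
    have "\<beta> ^ t \<le> 1 / (real t * ((1 + real n / 2) / m))"
      unfolding \<beta>_def using m \<open>m > 0\<close> \<open>t > 0\<close> by (intro one_minus_power_le) auto
    also have "\<dots> \<le> 1 / (real t * (real n / 2 / m))"
      using \<open>m > 0\<close> \<open>t > 0\<close> n by (intro divide_left_mono mult_left_mono divide_right_mono) auto
    finally have "real n * \<beta> ^ t \<le> real n * (1 / (real t * (real n / 2 / m)))"
      by (intro mult_left_mono) auto
    also have "\<dots> = 2 * m / real t" using n by (simp add: field_simps)
    finally show "real n * \<beta> ^ t \<le> 2 * m / real t" .
  qed
  have S: "?exp ?S \<le> \<rho> ^ t"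
    using expectation_variation_le[OF n, of v0 t] mult_left_mono[OF v0 rho(1)]
    unfolding m_def[symmetric] \<rho>_def[symmetric] by simp
  have D: "?exp ?D \<le> 2 / real n * \<rho> ^ t + \<beta> ^ t"
  proof -
    have "0 \<le> 2 / real n * \<rho> ^ t + \<beta> ^ t" using rho(1) beta(1) by simp
    from mult_left_mono[OF v0 this] show ?thesis
      using expectation_clique_variation_le[OF n, of v0 t]
      unfolding m_def[symmetric] \<rho>_def[symmetric] \<beta>_def[symmetric] by simp
  qed
  note int = integrable_averaging_law[OF finite_clique_leaf_edges clique_leaf_edges_nonempty]
  have "?exp (\<lambda>v. \<Sum>i<Suc n. \<bar>v i - mean_entry (Suc n) v0\<bar>)
      \<le> ?exp (\<lambda>v. \<epsilon> / 2 + (4 / \<epsilon> * ?S v + real n / \<epsilon> * ?D v))"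
  proof (rule expectation_averaging_law_mono[OF finite_clique_leaf_edges clique_leaf_edges_nonempty])
    fix v assume v: "v \<in> set_pmf (averaging_law ?E v0 t)"
    define z where "z = (\<Sum>i<Suc n. \<bar>v i - mean_entry (Suc n) v\<bar>)"
    \<comment> \<open>Bounding \<open>z\<close> by
      \<open>\<epsilon> / 2 + z\<^sup>2 / (2 * \<epsilon>)\<close> leaves only expectations of
      squares.\<close>
    have "2 * \<epsilon> * z \<le> \<epsilon>\<^sup>2 + z\<^sup>2"
      using sum_squares_bound[of \<epsilon> z] by simp
    also have "z\<^sup>2 \<le> 8 * ?S v + 2 * real n * ?D v"
      unfolding z_def using n by (intro l1_deviation_bound) simp
    finally have "z \<le> \<epsilon> / 2 + (4 / \<epsilon> * ?S v + real n / \<epsilon> * ?D v)"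
      using \<open>\<epsilon> > 0\<close> by (simp add: field_simps power2_eq_square)
    then show "(\<Sum>i<Suc n. \<bar>v i - mean_entry (Suc n) v0\<bar>)
        \<le> \<epsilon> / 2 + (4 / \<epsilon> * ?S v + real n / \<epsilon> * ?D v)"
      unfolding z_def using mean_entry_averaging_law[OF _ v] n by simp
  qed
  also have "\<dots> = \<epsilon> / 2 + (4 / \<epsilon> * ?exp ?S + real n / \<epsilon> * ?exp ?D)"
    by (simp add: int)
  also have "\<dots> \<le> \<epsilon> / 2 + (4 / \<epsilon> * \<rho> ^ t + real n / \<epsilon> * (2 / real n * \<rho> ^ t + \<beta> ^ t))"
    using S D \<open>\<epsilon> > 0\<close> by (intro add_left_mono add_mono mult_left_mono) auto
  also have "\<dots> = \<epsilon> / 2 + (6 * \<rho> ^ t + real n * \<beta> ^ t) / \<epsilon>"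
    using n \<open>\<epsilon> > 0\<close> by (simp add: field_simps)
  also have "\<dots> \<le> \<epsilon> / 2 + (6 * (4 * m / real t) + 2 * m / real t) / \<epsilon>"
    using rho(2) beta(2) \<open>\<epsilon> > 0\<close> by (intro add_left_mono divide_right_mono add_mono mult_left_mono) auto
  \<comment> \<open>The constant 52 is twice \<open>6 * 4 + 2\<close>, so the last fraction is at
    most \<open>\<epsilon> / 2\<close>.\<close>
  also have "\<dots> \<le> \<epsilon>"
    using t \<open>t > 0\<close> \<open>\<epsilon> > 0\<close> by (simp add: m_def field_simps power2_eq_square)
  finally show ?thesis .
qed

section \<open>Lower bound through an eigenfunction\<close>

text \<open>The coefficients form an eigenvector of the Laplacian for the eigenvalue \<open>1\<close>.\<close>

definition leaf_functional :: "nat \<Rightarrow> (nat \<Rightarrow> real) \<Rightarrow> real" where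
  "leaf_functional n v = (\<Sum>i\<in>{1..<n}. v i) - (real n - 1) * v n"

text \<open>Summed over all edges, averaging changes \<open>v\<close> by minus half its image under
  the Laplacian, and the eigenvalue is 1.\<close>

lemma leaf_functional_step:
  assumes "n \<ge> 2"
  shows "(\<Sum>e\<in>clique_leaf_edges n. leaf_functional n (average_edge v e))
    = (real (card (clique_leaf_edges n)) - 1 / 2) * leaf_functional n v"
proof -
  let ?F = "leaf_functional n"
  have F: "?F u = (\<Sum>i<n. u i) - u 0 - (real n - 1) * u n" for u
    using assms by (simp add: leaf_functional_def sum.atLeast1_atMost_eq lessThan_atLeast0
        sum.atLeast_Suc_lessThan[of 0 n])
  \<comment> \<open>A clique edge away from the vertex 0 joins two vertices of coefficient 1, so it
    preserves the functional.\<close>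
  have pair: "?F (average_edge v {i, j}) - ?F v = (if i = 0 then (v 0 - v j) / 2 else 0)"
    if "i < j" "j < n" for i j
  proof -
    have "(\<Sum>k<n. average_edge v {i, j} k) = (\<Sum>k<n. v k)"
      using sum_average_edge[of i n j "\<lambda>x. x" v] that by (simp add: field_simps)
    moreover have "average_edge v {i, j} n = v n" using that by (simp add: average_edge_def)
    moreover have "average_edge v {i, j} 0 = (if i = 0 then (v 0 + v j) / 2 else v 0)"
      using that by (simp add: average_edge_def)
    ultimately show ?thesis by (simp add: F field_simps)
  qed
  have leaf: "?F (average_edge v {0, n}) - ?F v = - ((real n - 1) * (v 0 - v n) / 2)"
  proof -
    have "(\<Sum>i\<in>{1..<n}. average_edge v {0, n} i) = (\<Sum>i\<in>{1..<n}. v i)"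
      by (intro sum.cong) (auto simp: average_edge_def)
    moreover have "average_edge v {0, n} n = (v 0 + v n) / 2"
      using assms by (simp add: average_edge_def)
    ultimately show ?thesis by (simp add: leaf_functional_def field_simps)
  qed
  have "(\<Sum>e\<in>clique_leaf_edges n. ?F (average_edge v e) - ?F v)
      = (\<Sum>j<n. \<Sum>i<j. if i = 0 then (v 0 - v j) / 2 else 0) - (real n - 1) * (v 0 - v n) / 2"
    using assms by (simp add: sum_clique_leaf_edges pair leaf)
  also have "(\<Sum>j<n. \<Sum>i<j. if i = 0 then (v 0 - v j) / 2 else 0) = (\<Sum>j<n. (v 0 - v j) / 2)"
    by (intro sum.cong) (auto simp: sum.delta)
  also have "\<dots> - (real n - 1) * (v 0 - v n) / 2 = - ?F v / 2"
    by (simp add: F sum_divide_distrib[symmetric] sum_subtractf field_simps)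
  finally show ?thesis by (simp add: sum_subtractf algebra_simps)
qed

lemma expectation_leaf_functional:
  assumes "n \<ge> 2"
  shows "measure_pmf.expectation (averaging_law (clique_leaf_edges n) v0 t) (leaf_functional n)
    = (1 - 1 / (2 * real (card (clique_leaf_edges n)))) ^ t * leaf_functional n v0"
proof (induction t)
  case (Suc t)
  let ?E = "clique_leaf_edges n"
  have m: "real (card ?E) > 0"
    using finite_clique_leaf_edges clique_leaf_edges_nonempty by (simp add: card_gt_0_iff)
  have "(\<lambda>v. (\<Sum>e\<in>?E. leaf_functional n (average_edge v e)) / real (card ?E))
      = (\<lambda>v. (1 - 1 / (2 * real (card ?E))) * leaf_functional n v)"
    unfolding leaf_functional_step[OF assms] using m by (intro ext) (simp add: field_simps)
  with Suc show ?case
    by (subst expectation_averaging_law_Suc[OF finite_clique_leaf_edges clique_leaf_edges_nonempty])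
       simp
qed simp

text \<open>The coefficients sum to zero, so any constant \<open>c\<close> may be subtracted, and
  none exceeds \<open>n - 1\<close> in absolute value.\<close>

lemma leaf_functional_le:
  assumes "n \<ge> 2"
  shows "- leaf_functional n v \<le> (real n - 1) * (\<Sum>i<Suc n. \<bar>v i - c\<bar>)"
proof -
  have "- leaf_functional n v = (\<Sum>i\<in>{1..<n}. c - v i) + (real n - 1) * (v n - c)"
    using assms by (simp add: leaf_functional_def sum_subtractf of_nat_diff algebra_simps)
  also have "\<dots> \<le> (\<Sum>i\<in>{1..<n}. (real n - 1) * \<bar>v i - c\<bar>) + (real n - 1) * \<bar>v n - c\<bar>"
  proof (intro add_mono sum_mono mult_left_mono)
    fix i
    have "c - v i \<le> 1 * \<bar>v i - c\<bar>" by simp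
    also have "\<dots> \<le> (real n - 1) * \<bar>v i - c\<bar>"
      using assms by (intro mult_right_mono) auto
    finally show "c - v i \<le> (real n - 1) * \<bar>v i - c\<bar>" .
  qed (use assms in auto)
  also have "\<dots> = (real n - 1) * (\<Sum>i\<in>{1..<Suc n}. \<bar>v i - c\<bar>)"
    using assms by (simp add: sum_distrib_left distrib_left)
  also have "\<dots> \<le> (real n - 1) * (\<Sum>i<Suc n. \<bar>v i - c\<bar>)"
    using assms by (intro mult_left_mono sum_mono2) auto
  finally show ?thesis .
qed

text \<open>At the indicator of the leaf the functional is \<open>- (n - 1)\<close>, which cancels
  the factor in \<open>leaf_functional_le\<close>. Bernoulli's inequality bounds the decay from
  below.\<close>

lemma expectation_l1_deviation_ge:
  assumes "n \<ge> 2"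
  defines "v0 \<equiv> \<lambda>i. of_bool (i = n)"
  shows "1 - real t / (2 * real (card (clique_leaf_edges n)))
    \<le> measure_pmf.expectation (averaging_law (clique_leaf_edges n) v0 t)
        (\<lambda>v. \<Sum>i<Suc n. \<bar>v i - c\<bar>)"
proof -
  let ?E = "clique_leaf_edges n"
  let ?exp = "measure_pmf.expectation (averaging_law ?E v0 t)"
  define a where "a = 1 / (2 * real (card ?E))"
  have "real (card ?E) \<ge> 1"
    using assms(1) by (simp add: card_clique_leaf_edges)
  then have a: "a \<le> 1" by (simp add: a_def field_simps)
  have v0: "leaf_functional n v0 = - (real n - 1)"
    by (simp add: leaf_functional_def v0_def)
  have "1 - real t * a \<le> (1 - a) ^ t"
    using Bernoulli_inequality[of "- a" t] a by simp
  then have "(real n - 1) * (1 - real t * a) \<le> (real n - 1) * (1 - a) ^ t"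
    using assms(1) by (intro mult_left_mono) auto
  also have "\<dots> = ?exp (\<lambda>v. - leaf_functional n v)"
    using expectation_leaf_functional[OF assms(1), of v0 t]
    by (simp add: v0 a_def algebra_simps)
  also have "\<dots> \<le> ?exp (\<lambda>v. (real n - 1) * (\<Sum>i<Suc n. \<bar>v i - c\<bar>))"
    using assms(1)
    by (intro expectation_averaging_law_mono finite_clique_leaf_edges clique_leaf_edges_nonempty
        leaf_functional_le)
  also have "\<dots> = (real n - 1) * ?exp (\<lambda>v. \<Sum>i<Suc n. \<bar>v i - c\<bar>)"
    by (simp del: sum.lessThan_Suc)
  finally show ?thesis
    using assms(1) by (simp add: a_def del: sum.lessThan_Suc)
qed

subsection \<open>The mixing time\<close>

lemma lp_norm_1: "lp_norm N 1 v = (\<Sum>i<N. \<bar>v i\<bar>)"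
  by (simp add: lp_norm_def sum_nonneg)

lemma lp_norm_2_eq_1_iff: "lp_norm N 2 v = 1 \<longleftrightarrow> (\<Sum>i<N. (v i)\<^sup>2) = 1"
proof -
  have "lp_norm N 2 v = sqrt (\<Sum>i<N. (v i)\<^sup>2)"
    by (simp add: lp_norm_def powr_half_sqrt sum_nonneg)
  then show ?thesis by simp
qed

text \<open>The exponents 1 disappear on nonnegative arguments, hence the check of the sign of the
  expectation.\<close>

lemma mixing_time_2_1:
  "mixing_time N E \<epsilon> 2 1 =
     Inf {enat t | t. \<forall>v0. (\<Sum>i<N. (v0 i)\<^sup>2) = 1 \<longrightarrow>
       measure_pmf.expectation (averaging_law E v0 t) (\<lambda>v. \<Sum>i<N. \<bar>v i - mean_entry N v0\<bar>) \<le> \<epsilon>}"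
proof -
  have "measure_pmf.expectation p (\<lambda>v. \<Sum>i<N. \<bar>v i - c\<bar>) \<ge> 0" for p :: "(nat \<Rightarrow> real) pmf" and c
    by (intro integral_nonneg_AE) (auto intro: sum_nonneg)
  then show ?thesis
    by (simp add: mixing_time_def lp_norm_1 lp_norm_2_eq_1_iff sum_nonneg)
qed

text \<open>Started at the indicator of the leaf, every admissible \<open>t\<close> satisfies
  \<open>1 - t / (2 * m) \<le> \<epsilon>\<close>, which bounds \<open>t\<close> from below.\<close>

lemma mixing_time_ge:
  assumes "n \<ge> 2"
  shows "ereal ((1 - \<epsilon>) * real (card (clique_leaf_edges n)))
    \<le> ereal_of_enat (mixing_time (Suc n) (clique_leaf_edges n) \<epsilon> 2 1)"
proof -
  define m where "m = real (card (clique_leaf_edges n))"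
  have m: "m > 0"
    using assms by (simp add: m_def card_clique_leaf_edges add_nonneg_pos)
  define k where "k = nat \<lceil>(1 - \<epsilon>) * m\<rceil>"
  have "enat k \<le> mixing_time (Suc n) (clique_leaf_edges n) \<epsilon> 2 1"
    unfolding mixing_time_2_1
  proof (rule Inf_greatest, clarify)
    fix t
    let ?v0 = "\<lambda>i. of_bool (i = n) :: real"
    assume t: "\<forall>v0. (\<Sum>i<Suc n. (v0 i)\<^sup>2) = 1 \<longrightarrow>
       measure_pmf.expectation (averaging_law (clique_leaf_edges n) v0 t)
         (\<lambda>v. \<Sum>i<Suc n. \<bar>v i - mean_entry (Suc n) v0\<bar>) \<le> \<epsilon>"
    have "measure_pmf.expectation (averaging_law (clique_leaf_edges n) ?v0 t)
         (\<lambda>v. \<Sum>i<Suc n. \<bar>v i - mean_entry (Suc n) ?v0\<bar>) \<le> \<epsilon>"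
      by (rule t[rule_format]) simp
    with expectation_l1_deviation_ge[OF assms, of t "mean_entry (Suc n) ?v0"]
    have le: "1 - real t / (2 * m) \<le> \<epsilon>" unfolding m_def by (rule order_trans)
    have "(1 - \<epsilon>) * m \<le> real t / (2 * m) * m"
      using le m by (intro mult_right_mono) auto
    also have "\<dots> \<le> real t" using m by simp
    finally have "(1 - \<epsilon>) * m \<le> real t" .
    then show "enat k \<le> enat t"
      by (simp add: k_def ceiling_le_iff)
  qed
  then have "ereal (real k) \<le> ereal_of_enat (mixing_time (Suc n) (clique_leaf_edges n) \<epsilon> 2 1)"
    using ereal_of_enat_le_iff[of "enat k"] by simp
  moreover have "(1 - \<epsilon>) * m \<le> real k"
    by (simp add: k_def real_nat_ceiling_ge)
  ultimately show ?thesis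
    unfolding m_def using order_trans ereal_less_eq(3) by blast
qed

lemma mixing_time_le:
  assumes "n \<ge> 2" and "0 < \<epsilon>" and "\<epsilon> < 1"
  shows "ereal_of_enat (mixing_time (Suc n) (clique_leaf_edges n) \<epsilon> 2 1)
    \<le> ereal (53 / \<epsilon>\<^sup>2 * real (card (clique_leaf_edges n)))"
proof -
  define m where "m = real (card (clique_leaf_edges n))"
  have m: "m \<ge> 1"
    using assms by (simp add: m_def card_clique_leaf_edges)
  define t where "t = nat \<lceil>52 / \<epsilon>\<^sup>2 * m\<rceil>"
  have "52 / \<epsilon>\<^sup>2 * m \<le> real t" by (simp add: t_def real_nat_ceiling_ge)
  then have "52 * m \<le> \<epsilon>\<^sup>2 * real t" using assms by (simp add: field_simps)
  \<comment> \<open>A start of Euclidean norm 1 has variation at most 1 by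
    \<open>variation_alt\<close>, so one \<open>t\<close> serves all starts.\<close>
  then have "mixing_time (Suc n) (clique_leaf_edges n) \<epsilon> 2 1 \<le> enat t"
    unfolding mixing_time_2_1 m_def
    using assms
    by (intro Inf_lower CollectI exI[of _ t] conjI refl allI impI expectation_l1_deviation_le)
       (simp_all add: variation_alt)
  then have "ereal_of_enat (mixing_time (Suc n) (clique_leaf_edges n) \<epsilon> 2 1) \<le> ereal (real t)"
    using ereal_of_enat_le_iff[of _ "enat t"] by simp
  \<comment> \<open>Rounding up adds at most 1, and \<open>m / \<epsilon>\<^sup>2 \<ge> 1\<close>
    absorbs it: 52 becomes 53.\<close>
  also have "ereal (real t) \<le> ereal (53 / \<epsilon>\<^sup>2 * m)"
  proof -
    define x where "x = m / \<epsilon>\<^sup>2"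
    have "\<epsilon>\<^sup>2 \<le> m"
      using m assms power_le_one[of \<epsilon> 2] by linarith
    then have "1 \<le> x" using assms by (simp add: x_def)
    moreover have "real t \<le> 52 * x + 1"
      using m by (simp add: t_def x_def)
    moreover have "53 / \<epsilon>\<^sup>2 * m = 53 * x" by (simp add: x_def)
    ultimately show ?thesis by simp
  qed
  finally show ?thesis by (simp add: m_def)
qed

theorem theorem1:
  fixes \<epsilon> :: real
  assumes "0 < \<epsilon>" and "\<epsilon> < 1"
  shows "\<exists>c C :: real. \<exists>N :: nat. c > 0 \<and> C > 0 \<and> N \<ge> 2 \<and>
    (\<forall>n\<ge>N.
       ereal (c * gamma_graph (n + 1) (clique_leaf_edges n))
         \<le> ereal_of_enat (mixing_time (n + 1) (clique_leaf_edges n) \<epsilon> 2 1) \<and>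
       ereal_of_enat (mixing_time (n + 1) (clique_leaf_edges n) \<epsilon> 2 1)
         \<le> ereal (C * gamma_graph (n + 1) (clique_leaf_edges n)))"
proof (intro exI conjI allI impI)
  show "1 - \<epsilon> > 0" "53 / \<epsilon>\<^sup>2 > 0" "(2 :: nat) \<ge> 2" using assms by auto
next
  fix n :: nat
  assume n: "n \<ge> 2"
  have \<gamma>: "gamma_graph (n + 1) (clique_leaf_edges n) = real (card (clique_leaf_edges n))"
    using lambda2_clique_leaf_edges[OF n] by (simp add: gamma_graph_def)
  show "ereal ((1 - \<epsilon>) * gamma_graph (n + 1) (clique_leaf_edges n))
      \<le> ereal_of_enat (mixing_time (n + 1) (clique_leaf_edges n) \<epsilon> 2 1)"
    unfolding \<gamma> using mixing_time_ge[OF n] by simp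
  show "ereal_of_enat (mixing_time (n + 1) (clique_leaf_edges n) \<epsilon> 2 1)
      \<le> ereal (53 / \<epsilon>\<^sup>2 * gamma_graph (n + 1) (clique_leaf_edges n))"
    unfolding \<gamma> using mixing_time_le[OF n assms] by simp
qed

end
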